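(* Let $G$ and $H$ be nontrivial finitely generated torsion-free nilpotent groups with Mal'cev bases $(a_1,\dots,a_m)$ and $(a_{m+1},\dots,a_n)$, respectively. Let $M$ and $N$ be the dimensions of Nickel's embeddings of $G$ and $H$ with respect to these Mal'cev bases. Then Nickel's embedding of $G\times H$ with respect to the Mal'cev basis $(a_1,\dots,a_m,a_{m+1},\dots,a_n)$ has dimension $M+N-1$.
   Context: A Mal'cev basis of a finitely generated torsion-free nilpotent group $G$ is a tuple $(a_1,\dots,a_n)$ of elements of $G$ such that every $g\in G$ can be written uniquely as $g=a_1^{x_1}\cdots a_n^{x_n}$ with $x_i\in\mathbb Z$, and such that $G=G_1>G_2>\cdots>G_n>1$ with $G_i=\langle a_i,\dots,a_n\rangle$ is a central series. $G$ and $H$ are regarded as subgroups of $G\times H$ in the usual way. Nickel's embedding with respect to a Mal'cev basis $(a_1,\dots,a_n)$: $G$ acts on $(\mathbb QG)^*$ (the space of $\mathbb{Q}$-linear maps $\mathbb QG\to\mathbb Q$, identified with functions $G\to\mathbb Q$) by $f^g(h)=f(hg^{-1})$. The coordinate functions are $t_i:G\to\mathbb Z$, $t_i(a_1^{x_1}\cdots a_n^{x_n})=x_i$. The $G$-submodule of $(\mathbb QG)^*$ generated by $t_1,\dots,t_n$ is a finite-dimensional faithful $G$-module, and Nickel's embedding is the resulting unitriangular matrix representation of $G$. Its dimension is the dimension over $\mathbb Q$ of this $G$-submodule. *)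

theory Defs
  imports "HOL-Algebra.Algebra" "HOL-Library.Function_Algebras" "HOL-Library.Extended_Nat"
begin

section \<open>Finitely generated torsion-free nilpotent groups\<close>

definition finitely_generated_group :: "('a, 'm) monoid_scheme \<Rightarrow> bool" where
  "finitely_generated_group G \<longleftrightarrow>
     (\<exists>S. finite S \<and> S \<subseteq> carrier G \<and> generate G S = carrier G)"

definition torsion_free_group :: "('a, 'm) monoid_scheme \<Rightarrow> bool" where
  "torsion_free_group G \<longleftrightarrow>
     (\<forall>x \<in> carrier G. \<forall>k::nat. 0 < k \<longrightarrow> x [^]\<^bsub>G\<^esub> k = \<one>\<^bsub>G\<^esub> \<longrightarrow> x = \<one>\<^bsub>G\<^esub>)"

text \<open>The commutator condition says that each \<open>S i / S (Suc i)\<close> is central in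
  \<open>G / S (Suc i)\<close>.\<close>

definition central_series :: "('a, 'm) monoid_scheme \<Rightarrow> (nat \<Rightarrow> 'a set) \<Rightarrow> nat \<Rightarrow> bool" where
  "central_series G S n \<longleftrightarrow>
     S 0 = carrier G \<and> S n = {\<one>\<^bsub>G\<^esub>} \<and>
     (\<forall>i\<le>n. S i \<lhd> G) \<and>
     (\<forall>i<n. S (Suc i) \<subseteq> S i \<and>
        (\<forall>x \<in> S i. \<forall>g \<in> carrier G.
           x \<otimes>\<^bsub>G\<^esub> g \<otimes>\<^bsub>G\<^esub> inv\<^bsub>G\<^esub> x \<otimes>\<^bsub>G\<^esub> inv\<^bsub>G\<^esub> g \<in> S (Suc i)))"

definition nilpotent_group :: "('a, 'm) monoid_scheme \<Rightarrow> bool" where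
  "nilpotent_group G \<longleftrightarrow> group G \<and> (\<exists>S n. central_series G S n)"


section \<open>Mal'cev bases\<close>

definition malcev_word :: "('a, 'm) monoid_scheme \<Rightarrow> 'a list \<Rightarrow> int list \<Rightarrow> 'a" where
  "malcev_word G as xs =
     foldr (\<lambda>(a, x) g. (a [^]\<^bsub>G\<^esub> x) \<otimes>\<^bsub>G\<^esub> g) (zip as xs) \<one>\<^bsub>G\<^esub>"

text \<open>Lists are indexed from 0, so \<open>generate G (set (drop i as))\<close> is the subgroup usually
  written \<open>G\<close> with index \<open>i + 1\<close>; for \<open>i = length as\<close> it is trivial.\<close>

definition malcev_basis :: "('a, 'm) monoid_scheme \<Rightarrow> 'a list \<Rightarrow> bool" where
  "malcev_basis G as \<longleftrightarrow>
     set as \<subseteq> carrier G \<and>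
     (\<forall>g \<in> carrier G. \<exists>!xs. length xs = length as \<and> g = malcev_word G as xs) \<and>
     central_series G (\<lambda>i. generate G (set (drop i as))) (length as) \<and>
     (\<forall>i < length as. generate G (set (drop (Suc i) as)) \<subset> generate G (set (drop i as)))"

definition malcev_exponents :: "('a, 'm) monoid_scheme \<Rightarrow> 'a list \<Rightarrow> 'a \<Rightarrow> int list" where
  "malcev_exponents G as g = (THE xs. length xs = length as \<and> g = malcev_word G as xs)"


section \<open>The dual of the rational group algebra\<close>

text \<open>A linear map from the rational group algebra of \<open>G\<close> to the rationals is identified with a
  function on \<open>carrier G\<close>, extended by 0 to the whole type.\<close>

definition dual_group_algebra :: "('a, 'm) monoid_scheme \<Rightarrow> ('a \<Rightarrow> rat) set" where
  "dual_group_algebra G = {f. \<forall>h. h \<notin> carrier G \<longrightarrow> f h = 0}"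

definition fun_scale :: "rat \<Rightarrow> ('a \<Rightarrow> rat) \<Rightarrow> 'a \<Rightarrow> rat" where
  "fun_scale q f = (\<lambda>h. q * f h)"

interpretation rat_fun: vector_space fun_scale
  by standard (auto simp: fun_scale_def fun_eq_iff algebra_simps)

definition dual_act :: "('a, 'm) monoid_scheme \<Rightarrow> ('a \<Rightarrow> rat) \<Rightarrow> 'a \<Rightarrow> 'a \<Rightarrow> rat" where
  "dual_act G f g = (\<lambda>h. if h \<in> carrier G then f (h \<otimes>\<^bsub>G\<^esub> inv\<^bsub>G\<^esub> g) else 0)"

definition dual_submodule :: "('a, 'm) monoid_scheme \<Rightarrow> ('a \<Rightarrow> rat) set \<Rightarrow> bool" where
  "dual_submodule G W \<longleftrightarrow>
     W \<subseteq> dual_group_algebra G \<and> rat_fun.subspace W \<and>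
     (\<forall>f \<in> W. \<forall>g \<in> carrier G. dual_act G f g \<in> W)"


section \<open>Nickel's embedding\<close>

definition malcev_coordinate ::
    "('a, 'm) monoid_scheme \<Rightarrow> 'a list \<Rightarrow> nat \<Rightarrow> 'a \<Rightarrow> rat" where
  "malcev_coordinate G as i =
     (\<lambda>g. if g \<in> carrier G then of_int (malcev_exponents G as g ! i) else 0)"

definition nickel_module :: "('a, 'm) monoid_scheme \<Rightarrow> 'a list \<Rightarrow> ('a \<Rightarrow> rat) set" where
  "nickel_module G as = dual_submodule G hull (malcev_coordinate G as ` {..<length as})"

text \<open>The library's \<open>dim\<close> takes the junk value 0 on infinite-dimensional spaces. Here an
  infinite-dimensional space has dimension \<open>\<infinity>\<close> instead, so that a finite value really is
  the dimension.\<close>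

definition rat_dimension :: "('a \<Rightarrow> rat) set \<Rightarrow> enat" where
  "rat_dimension V =
     (if \<exists>B. finite B \<and> V \<subseteq> rat_fun.span B then enat (rat_fun.dim V) else \<infinity>)"

definition nickel_dimension :: "('a, 'm) monoid_scheme \<Rightarrow> 'a list \<Rightarrow> enat" where
  "nickel_dimension G as = rat_dimension (nickel_module G as)"

end

theory Submission
  imports Defs
begin

text \<open>Inflating functions along the two projections of \<open>G \<times>\<times> H\<close> is linear, injective and compatible
  with the actions, and it turns the coordinates of \<open>G\<close> and of \<open>H\<close> into those of the product.
  Hence the Nickel module of the product is the sum of the inflated Nickel modules of the factors.
  A function in both summands depends on neither component, so it is constant. Conversely the
  constants lie in both: if \<open>t\<close> is the last coordinate with respect to a Mal'cev basis ending in
  \<open>a\<close>, then \<open>t\<close> minus its translate by \<open>a\<close> is the constant 1. So the intersection is a line, and the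
  dimensions add up to one more than the dimension of the sum.\<close>

section \<open>Mal'cev words\<close>

lemma malcev_word_Nil [simp]: "malcev_word G [] xs = \<one>\<^bsub>G\<^esub>"
  by (simp add: malcev_word_def)

lemma malcev_word_Cons [simp]:
  "malcev_word G (a # as) (x # xs) = a [^]\<^bsub>G\<^esub> x \<otimes>\<^bsub>G\<^esub> malcev_word G as xs"
  by (simp add: malcev_word_def)

lemma malcev_word_Nil2 [simp]: "malcev_word G as [] = \<one>\<^bsub>G\<^esub>"
  by (simp add: malcev_word_def)

lemma (in group) malcev_word_closed:
  "set as \<subseteq> carrier G \<Longrightarrow> malcev_word G as xs \<in> carrier G"
proof (induction as arbitrary: xs)
  case (Cons a as)
  then show ?case by (cases xs) auto
qed simp

lemma (in group) malcev_word_append: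
  assumes "set as \<subseteq> carrier G" "set bs \<subseteq> carrier G" "length xs = length as"
  shows "malcev_word G (as @ bs) (xs @ ys) = malcev_word G as xs \<otimes> malcev_word G bs ys"
  using assms(3,1)
proof (induction xs as rule: list_induct2)
  case Nil
  then show ?case using assms(2) by (simp add: malcev_word_closed)
next
  case (Cons x xs a as)
  then show ?case using assms(2) by (simp add: m_assoc malcev_word_closed)
qed

lemma (in group_hom) hom_malcev_word:
  "set as \<subseteq> carrier G \<Longrightarrow> h (malcev_word G as xs) = malcev_word H (map h as) xs"
proof (induction as arbitrary: xs)
  case (Cons a as)
  then show ?case
    by (cases xs) (auto simp: hom_int_pow G.malcev_word_closed)
qed simp

text \<open>Turns the definite description into a computation rule: to find the exponents of an
  element it is enough to exhibit one word of the right length for it.\<close>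

lemma malcev_exponents_word:
  assumes "malcev_basis G as" "length xs = length as" "malcev_word G as xs \<in> carrier G"
  shows "malcev_exponents G as (malcev_word G as xs) = xs"
  unfolding malcev_exponents_def
proof (rule the_equality)
  fix ys assume "length ys = length as \<and> malcev_word G as xs = malcev_word G as ys"
  moreover have "\<exists>!zs. length zs = length as \<and> malcev_word G as xs = malcev_word G as zs"
    using assms(1,3) unfolding malcev_basis_def by blast
  ultimately show "ys = xs" using assms(2) by blast
qed (use assms in simp)

lemma malcev_exponents:
  assumes "malcev_basis G as" "g \<in> carrier G"
  shows "length (malcev_exponents G as g) = length as"
    and "malcev_word G as (malcev_exponents G as g) = g"
proof -
  have "\<exists>!xs. length xs = length as \<and> g = malcev_word G as xs"
    using assms unfolding malcev_basis_def by blast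
  from theI'[OF this] show "length (malcev_exponents G as g) = length as"
    and "malcev_word G as (malcev_exponents G as g) = g"
    unfolding malcev_exponents_def by auto
qed


section \<open>The basis of a direct product\<close>

definition prod_basis ::
    "('a, 'm) monoid_scheme \<Rightarrow> ('b, 'n) monoid_scheme \<Rightarrow> 'a list \<Rightarrow> 'b list \<Rightarrow> ('a \<times> 'b) list" where
  "prod_basis G H as bs = map (\<lambda>a. (a, \<one>\<^bsub>H\<^esub>)) as @ map (\<lambda>b. (\<one>\<^bsub>G\<^esub>, b)) bs"

lemma length_prod_basis [simp]: "length (prod_basis G H as bs) = length as + length bs"
  by (simp add: prod_basis_def)

text \<open>The subtraction is truncated: as long as \<open>i \<le> length as\<close> the list
  \<open>bs\<close> stays whole, and from there on \<open>drop i as\<close> is empty.\<close>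

lemma drop_prod_basis:
  "drop i (prod_basis G H as bs) = prod_basis G H (drop i as) (drop (i - length as) bs)"
  by (simp add: prod_basis_def drop_map)

locale group_pair = G: group G + H: group H
  for G :: "('a, 'm) monoid_scheme" and H :: "('b, 'n) monoid_scheme"
begin

sublocale prod: group "G \<times>\<times> H"
  by (rule DirProd_group) unfold_locales

sublocale fst: group_hom "G \<times>\<times> H" G fst
  by unfold_locales (auto simp: hom_def)

sublocale snd: group_hom "G \<times>\<times> H" H snd
  by unfold_locales (auto simp: hom_def)

text \<open>The two injections are not sublocales: their simp rule \<open>hom_one\<close> would loop with
  \<open>one_DirProd\<close>.\<close>

lemma group_hom_inl: "group_hom G (G \<times>\<times> H) (\<lambda>a. (a, \<one>\<^bsub>H\<^esub>))"
  by unfold_locales (auto simp: hom_def)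

lemma group_hom_inr: "group_hom H (G \<times>\<times> H) (\<lambda>b. (\<one>\<^bsub>G\<^esub>, b))"
  by unfold_locales (auto simp: hom_def)

lemma set_prod_basis_subset:
  "set as \<subseteq> carrier G \<Longrightarrow> set bs \<subseteq> carrier H \<Longrightarrow>
    set (prod_basis G H as bs) \<subseteq> carrier (G \<times>\<times> H)"
  by (auto simp: prod_basis_def)

text \<open>The injections of the factors are homomorphisms, so they commute with forming words, and
  \<open>(g, h)\<close> is the product of \<open>(g, \<one>)\<close> and
  \<open>(\<one>, h)\<close>.\<close>

lemma malcev_word_prod_basis:
  assumes "set as \<subseteq> carrier G" "set bs \<subseteq> carrier H" "length xs = length as"
  shows "malcev_word (G \<times>\<times> H) (prod_basis G H as bs) (xs @ ys) =
    (malcev_word G as xs, malcev_word H bs ys)"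
proof -
  have "malcev_word (G \<times>\<times> H) (prod_basis G H as bs) (xs @ ys) =
      (malcev_word G as xs, \<one>\<^bsub>H\<^esub>) \<otimes>\<^bsub>G \<times>\<times> H\<^esub> (\<one>\<^bsub>G\<^esub>, malcev_word H bs ys)"
    unfolding prod_basis_def group_hom.hom_malcev_word[OF group_hom_inl assms(1)]
      group_hom.hom_malcev_word[OF group_hom_inr assms(2)]
    using assms by (intro prod.malcev_word_append) auto
  then show ?thesis
    using assms by (simp add: G.malcev_word_closed H.malcev_word_closed)
qed

text \<open>The product of the two subgroups is a subgroup containing all generators. Conversely,
  both injections map generated subgroups into the left-hand side, and a pair is the product of its
  injected components.\<close>

lemma generate_prod_basis:
  assumes "set as \<subseteq> carrier G" "set bs \<subseteq> carrier H"
  shows "generate (G \<times>\<times> H) (set (prod_basis G H as bs)) =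
    generate G (set as) \<times> generate H (set bs)"
proof
  have "subgroup (generate G (set as) \<times> generate H (set bs)) (G \<times>\<times> H)"
    using assms by (intro DirProd_subgroups G.generate_is_subgroup H.generate_is_subgroup)
      unfold_locales
  then show "generate (G \<times>\<times> H) (set (prod_basis G H as bs)) \<subseteq>
      generate G (set as) \<times> generate H (set bs)"
    by (rule prod.generate_subgroup_incl[rotated])
      (auto simp: prod_basis_def intro: generate.intros)
next
  let ?K = "generate (G \<times>\<times> H) (set (prod_basis G H as bs))"
  have "(a, \<one>\<^bsub>H\<^esub>) \<in> ?K" if "a \<in> generate G (set as)" for a
    using that group_hom.generate_img[OF group_hom_inl assms(1)]
      prod.mono_generate[of "(\<lambda>a. (a, \<one>\<^bsub>H\<^esub>)) ` set as" "set (prod_basis G H as bs)"]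
    by (auto simp: prod_basis_def)
  moreover have "(\<one>\<^bsub>G\<^esub>, b) \<in> ?K" if "b \<in> generate H (set bs)" for b
    using that group_hom.generate_img[OF group_hom_inr assms(2)]
      prod.mono_generate[of "(\<lambda>b. (\<one>\<^bsub>G\<^esub>, b)) ` set bs" "set (prod_basis G H as bs)"]
    by (auto simp: prod_basis_def)
  ultimately have "(a, \<one>\<^bsub>H\<^esub>) \<otimes>\<^bsub>G \<times>\<times> H\<^esub> (\<one>\<^bsub>G\<^esub>, b) \<in> ?K"
    if "a \<in> generate G (set as)" "b \<in> generate H (set bs)" for a b
    using that by (intro generate.eng) auto
  then show "generate G (set as) \<times> generate H (set bs) \<subseteq> ?K"
    using assms G.generate_in_carrier H.generate_in_carrier by fastforce
qed

text \<open>The series of the product first descends through \<open>G\<close> with all of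
  \<open>H\<close> kept, then through \<open>H\<close> with the trivial subgroup of
  \<open>G\<close>. At each index only one factor moves, and its own series supplies the
  condition.\<close>

lemma malcev_basis_prod_basis:
  assumes "malcev_basis G as" "malcev_basis H bs"
  shows "malcev_basis (G \<times>\<times> H) (prod_basis G H as bs)"
proof -
  let ?cs = "prod_basis G H as bs" and ?m = "length as" and ?n = "length bs"
  let ?A = "\<lambda>i. generate G (set (drop i as))" and ?B = "\<lambda>i. generate H (set (drop i bs))"
  let ?C = "\<lambda>i. generate (G \<times>\<times> H) (set (drop i ?cs))"
  have as: "set as \<subseteq> carrier G" and bs: "set bs \<subseteq> carrier H"
    and cA: "central_series G ?A ?m" and cB: "central_series H ?B ?n"
    and sA: "\<And>i. i < ?m \<Longrightarrow> ?A (Suc i) \<subset> ?A i" and sB: "\<And>i. i < ?n \<Longrightarrow> ?B (Suc i) \<subset> ?B i"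
    using assms unfolding malcev_basis_def by auto
  have A0: "?A 0 = carrier G" and nA: "\<And>i. i \<le> ?m \<Longrightarrow> ?A i \<lhd> G"
    and commA: "\<And>i x g. i < ?m \<Longrightarrow> x \<in> ?A i \<Longrightarrow> g \<in> carrier G \<Longrightarrow>
      x \<otimes>\<^bsub>G\<^esub> g \<otimes>\<^bsub>G\<^esub> inv\<^bsub>G\<^esub> x \<otimes>\<^bsub>G\<^esub> inv\<^bsub>G\<^esub> g \<in> ?A (Suc i)"
    using cA unfolding central_series_def by blast+
  have B0: "?B 0 = carrier H" and nB: "\<And>i. i \<le> ?n \<Longrightarrow> ?B i \<lhd> H"
    and commB: "\<And>i x g. i < ?n \<Longrightarrow> x \<in> ?B i \<Longrightarrow> g \<in> carrier H \<Longrightarrow>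
      x \<otimes>\<^bsub>H\<^esub> g \<otimes>\<^bsub>H\<^esub> inv\<^bsub>H\<^esub> x \<otimes>\<^bsub>H\<^esub> inv\<^bsub>H\<^esub> g \<in> ?B (Suc i)"
    using cB unfolding central_series_def by blast+
  have C: "?C i = ?A i \<times> ?B (i - ?m)" for i
    unfolding drop_prod_basis using as bs
    by (intro generate_prod_basis) (auto dest: in_set_dropD)
  have nonempty: "?A i \<noteq> {}" "?B i \<noteq> {}" for i
    using generate.one by blast+
  \<comment> \<open>The series of \<open>G\<close> is needed also at indices beyond its length,
    where no generators are left.\<close>
  have A_trivial: "?A i = {\<one>\<^bsub>G\<^esub>}" if "i \<ge> ?m" for i
    using that by (simp add: G.generate_empty)
  have B_trivial: "?B ?n = {\<one>\<^bsub>H\<^esub>}"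
    by (simp add: H.generate_empty)
  have unique: "\<exists>!zs. length zs = length ?cs \<and> p = malcev_word (G \<times>\<times> H) ?cs zs"
    if p_in: "p \<in> carrier (G \<times>\<times> H)" for p
  proof -
    obtain g h where p: "p = (g, h)" "g \<in> carrier G" "h \<in> carrier H"
      using p_in by auto
    show ?thesis
    proof (rule ex1I)
      show "length (malcev_exponents G as g @ malcev_exponents H bs h) = length ?cs \<and>
          p = malcev_word (G \<times>\<times> H) ?cs (malcev_exponents G as g @ malcev_exponents H bs h)"
        using p malcev_exponents[OF assms(1)] malcev_exponents[OF assms(2)]
        by (simp add: malcev_word_prod_basis[OF as bs])
    next
      \<comment> \<open>Cutting \<open>zs\<close> after \<open>?m\<close> entries gives words for
        both components, so uniqueness in each factor fixes both pieces.\<close>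
      fix zs assume zs: "length zs = length ?cs \<and> p = malcev_word (G \<times>\<times> H) ?cs zs"
      then have "(g, h) = (malcev_word G as (take ?m zs), malcev_word H bs (drop ?m zs))"
        using malcev_word_prod_basis[OF as bs, of "take ?m zs" "drop ?m zs"] p by simp
      then have "malcev_exponents G as g = take ?m zs" "malcev_exponents H bs h = drop ?m zs"
        using malcev_exponents_word[OF assms(1), of "take ?m zs"]
          malcev_exponents_word[OF assms(2), of "drop ?m zs"] p zs by auto
      then show "zs = malcev_exponents G as g @ malcev_exponents H bs h" by simp
    qed
  qed
  have C0: "?C 0 = carrier (G \<times>\<times> H)"
    unfolding C using A0 B0 by simp
  have Cn: "?C (length ?cs) = {\<one>\<^bsub>G \<times>\<times> H\<^esub>}"
    unfolding C using A_trivial[of "length ?cs"] B_trivial by simp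
  have nC: "?C i \<lhd> G \<times>\<times> H" if "i \<le> length ?cs" for i
  proof -
    \<comment> \<open>The series of \<open>G\<close> gives normality only for
      \<open>i \<le> ?m\<close>; for larger \<open>i\<close> the subgroup equals the one at
      \<open>?m\<close>.\<close>
    have "?A i \<lhd> G"
      using nA[of i] nA[of ?m] A_trivial[of i] A_trivial[of ?m] by (metis linear order_refl)
    moreover have "?B (i - ?m) \<lhd> H"
      using that by (intro nB) simp
    ultimately show ?thesis
      unfolding C by (intro G.DirProd_normal H.is_group)
  qed
  have dC: "?C (Suc i) \<subseteq> ?C i" for i
    by (intro prod.mono_generate set_drop_subset_set_drop) simp
  have commC: "x \<otimes>\<^bsub>G \<times>\<times> H\<^esub> y \<otimes>\<^bsub>G \<times>\<times> H\<^esub> inv\<^bsub>G \<times>\<times> H\<^esub> x \<otimes>\<^bsub>G \<times>\<times> H\<^esub> inv\<^bsub>G \<times>\<times> H\<^esub> y \<in> ?C (Suc i)"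
    if i: "i < length ?cs" and x: "x \<in> ?C i" and y: "y \<in> carrier (G \<times>\<times> H)" for i x y
  proof -
    obtain a b g h where ab: "x = (a, b)" "a \<in> ?A i" "b \<in> ?B (i - ?m)"
      and gh: "y = (g, h)" "g \<in> carrier G" "h \<in> carrier H"
      using x y unfolding C by auto
    have a: "a \<in> carrier G" and b: "b \<in> carrier H"
      using ab as bs set_drop_subset
      by (meson G.generate_in_carrier H.generate_in_carrier subset_trans)+
    have "a \<otimes>\<^bsub>G\<^esub> g \<otimes>\<^bsub>G\<^esub> inv\<^bsub>G\<^esub> a \<otimes>\<^bsub>G\<^esub> inv\<^bsub>G\<^esub> g \<in> ?A (Suc i)"
    proof (cases "i < ?m")
      case True
      then show ?thesis using commA ab gh by blast
    next
      case False
      then show ?thesis using A_trivial[of i] A_trivial[of "Suc i"] ab gh by simp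
    qed
    moreover have "b \<otimes>\<^bsub>H\<^esub> h \<otimes>\<^bsub>H\<^esub> inv\<^bsub>H\<^esub> b \<otimes>\<^bsub>H\<^esub> inv\<^bsub>H\<^esub> h \<in> ?B (Suc i - ?m)"
    proof (cases "i < ?m")
      case True
      \<comment> \<open>From \<open>i < ?m\<close> the truncated difference is 0, so the
        \<open>H\<close> component only has to lie in the carrier.\<close>
      then have "?B (Suc i - ?m) = carrier H" using B0 by simp
      then show ?thesis using b gh by simp
    next
      case False
      then have "Suc i - ?m = Suc (i - ?m)" "i - ?m < ?n" using i by auto
      then show ?thesis using commB ab gh by metis
    qed
    ultimately show ?thesis
      unfolding C using ab(1) gh a b by simp
  qed
  have cC: "central_series (G \<times>\<times> H) ?C (length ?cs)"
    unfolding central_series_def using C0 Cn nC dC commC by blast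
  have sC: "?C (Suc i) \<subset> ?C i" if "i < length ?cs" for i
  proof -
    have "?A (Suc i) \<noteq> ?A i \<or> ?B (Suc i - ?m) \<noteq> ?B (i - ?m)"
    proof (cases "i < ?m")
      case False
      then have "Suc i - ?m = Suc (i - ?m)" "i - ?m < ?n" using that by auto
      then show ?thesis using sB[of "i - ?m"] by force
    qed (use sA[of i] in force)
    \<comment> \<open>A product of nonempty sets determines its factors, so a change in one factor
      changes the product.\<close>
    then have "?C (Suc i) \<noteq> ?C i"
      unfolding C times_eq_iff using nonempty by blast
    then show ?thesis using dC[of i] by blast
  qed
  show ?thesis
    unfolding malcev_basis_def
    using set_prod_basis_subset[OF as bs] unique cC sC by blast
qed

end


section \<open>Submodules of the dual group algebra\<close>

definition dual_orbit ::
    "('a, 'm) monoid_scheme \<Rightarrow> ('a \<Rightarrow> rat) set \<Rightarrow> ('a \<Rightarrow> rat) set" where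
  "dual_orbit G T = {dual_act G f g |f g. f \<in> T \<and> g \<in> carrier G}"

lemma dual_orbit_Un: "dual_orbit G (S \<union> T) = dual_orbit G S \<union> dual_orbit G T"
  by (auto simp: dual_orbit_def)

lemma module_hom_dual_act: "module_hom fun_scale fun_scale (\<lambda>f. dual_act G f g)"
  by unfold_locales (auto simp: dual_act_def fun_scale_def fun_eq_iff algebra_simps)

lemma subspace_dual_group_algebra: "rat_fun.subspace (dual_group_algebra G)"
  by (rule rat_fun.subspaceI) (auto simp: dual_group_algebra_def fun_scale_def)

lemma (in group) dual_act_one:
  "f \<in> dual_group_algebra G \<Longrightarrow> dual_act G f \<one> = f"
  by (auto simp: dual_act_def dual_group_algebra_def fun_eq_iff)

text \<open>A right action, since inversion reverses products:
  \<open>inv (g \<otimes> k) = inv k \<otimes> inv g\<close>.\<close>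

lemma (in group) dual_act_dual_act:
  assumes "g \<in> carrier G" "k \<in> carrier G"
  shows "dual_act G (dual_act G f g) k = dual_act G f (g \<otimes> k)"
  using assms by (auto simp: dual_act_def fun_eq_iff inv_mult_group m_assoc)

text \<open>The set of translates is stable under the action, and each group element acts linearly,
  so the stability passes to the span.\<close>

lemma (in group) dual_submodule_span_orbit: "dual_submodule G (rat_fun.span (dual_orbit G T))"
proof -
  have act: "dual_act G f g \<in> dual_orbit G T" if "f \<in> dual_orbit G T" "g \<in> carrier G" for f g
    using that unfolding dual_orbit_def
    by clarsimp (metis dual_act_dual_act m_closed)
  have "dual_act G f g \<in> rat_fun.span (dual_orbit G T)"
    if f: "f \<in> rat_fun.span (dual_orbit G T)" and g: "g \<in> carrier G" for f g
  proof -
    have "dual_act G f g \<in> (\<lambda>f. dual_act G f g) ` rat_fun.span (dual_orbit G T)"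
      using f by blast
    also have "\<dots> = rat_fun.span ((\<lambda>f. dual_act G f g) ` dual_orbit G T)"
      by (rule module_hom.span_image[OF module_hom_dual_act, symmetric])
    also have "\<dots> \<subseteq> rat_fun.span (dual_orbit G T)"
      using act g by (intro rat_fun.span_mono) blast
    finally show ?thesis .
  qed
  moreover have "rat_fun.span (dual_orbit G T) \<subseteq> dual_group_algebra G"
    by (rule rat_fun.span_minimal[OF _ subspace_dual_group_algebra])
      (auto simp: dual_orbit_def dual_group_algebra_def dual_act_def)
  ultimately show ?thesis
    unfolding dual_submodule_def by simp
qed

text \<open>A submodule containing \<open>T\<close> contains every translate and, being a subspace,
  their span. This replaces the intersection of submodules by a span, to which linear maps and
  unions can be applied.\<close>

lemma (in group) dual_submodule_hull:
  assumes "T \<subseteq> dual_group_algebra G"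
  shows "dual_submodule G hull T = rat_fun.span (dual_orbit G T)"
proof (rule hull_unique)
  show "T \<subseteq> rat_fun.span (dual_orbit G T)"
  proof
    fix f assume "f \<in> T"
    \<comment> \<open>Translating by the identity returns \<open>f\<close> itself because
      \<open>f\<close> vanishes off the carrier.\<close>
    then have "dual_act G f \<one> \<in> dual_orbit G T" unfolding dual_orbit_def by blast
    then show "f \<in> rat_fun.span (dual_orbit G T)"
      using \<open>f \<in> T\<close> assms by (metis dual_act_one rat_fun.span_base subsetD)
  qed
next
  fix W assume "T \<subseteq> W" "dual_submodule G W"
  then show "rat_fun.span (dual_orbit G T) \<subseteq> W"
    by (intro rat_fun.span_minimal) (auto simp: dual_submodule_def dual_orbit_def)
qed (rule dual_submodule_span_orbit)

section \<open>Inflation of functions along a map of groups\<close>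

definition inflate ::
    "('c, 'k) monoid_scheme \<Rightarrow> ('c \<Rightarrow> 'a) \<Rightarrow> ('a \<Rightarrow> rat) \<Rightarrow> 'c \<Rightarrow> rat" where
  "inflate K p f = (\<lambda>x. if x \<in> carrier K then f (p x) else 0)"

lemma module_hom_inflate: "module_hom fun_scale fun_scale (inflate K p)"
  by unfold_locales (auto simp: inflate_def fun_scale_def fun_eq_iff)

lemma inflate_in_dual: "inflate K p f \<in> dual_group_algebra K"
  by (simp add: inflate_def dual_group_algebra_def)

text \<open>Surjectivity lets each value on \<open>carrier G\<close> be read off at a preimage; off
  the carrier both functions are 0.\<close>

lemma inj_on_inflate:
  assumes "p ` carrier K = carrier G"
  shows "inj_on (inflate K p) (dual_group_algebra G)"
proof (rule inj_onI, rule ext)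
  fix f f' x
  assume f: "f \<in> dual_group_algebra G" "f' \<in> dual_group_algebra G"
    and eq: "inflate K p f = inflate K p f'"
  show "f x = f' x"
  proof (cases "x \<in> carrier G")
    case True
    then obtain k where "k \<in> carrier K" "x = p k" using assms by blast
    then show ?thesis using fun_cong[OF eq, of k] by (simp add: inflate_def)
  qed (use f in \<open>simp add: dual_group_algebra_def\<close>)
qed

lemma (in group_hom) inflate_dual_act:
  assumes "x \<in> carrier G"
  shows "inflate G h (dual_act H f (h x)) = dual_act G (inflate G h f) x"
  using assms by (auto simp: inflate_def dual_act_def fun_eq_iff)

text \<open>As \<open>h\<close> is surjective, every translation by an element of \<open>H\<close>
  is a translation by some \<open>h x\<close>, so inflation carries orbits onto orbits. Being
  linear, it then carries spans onto spans.\<close>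

lemma (in group_hom) inflate_hull:
  assumes "h ` carrier G = carrier H" "T \<subseteq> dual_group_algebra H"
  shows "dual_submodule G hull (inflate G h ` T) = inflate G h ` (dual_submodule H hull T)"
proof -
  have "dual_orbit G (inflate G h ` T) = inflate G h ` dual_orbit H T"
  proof (intro subset_antisym subsetI)
    fix f assume "f \<in> dual_orbit G (inflate G h ` T)"
    then obtain t x where "f = dual_act G (inflate G h t) x" "t \<in> T" "x \<in> carrier G"
      by (auto simp: dual_orbit_def)
    moreover from calculation have "dual_act H t (h x) \<in> dual_orbit H T"
      unfolding dual_orbit_def using hom_closed by blast
    ultimately show "f \<in> inflate G h ` dual_orbit H T"
      by (simp flip: inflate_dual_act)
  next
    fix f assume "f \<in> inflate G h ` dual_orbit H T"
    then obtain t x where "f = inflate G h (dual_act H t (h x))" "t \<in> T" "x \<in> carrier G"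
      unfolding dual_orbit_def assms(1)[symmetric] by blast
    then show "f \<in> dual_orbit G (inflate G h ` T)"
      by (auto simp: dual_orbit_def inflate_dual_act)
  qed
  moreover have "inflate G h ` T \<subseteq> dual_group_algebra G"
    using inflate_in_dual by blast
  ultimately show ?thesis
    using assms(2) by (simp add: G.dual_submodule_hull H.dual_submodule_hull
        module_hom.span_image[OF module_hom_inflate])
qed

lemma (in group) dual_submodule_hull_Un:
  assumes "S \<subseteq> dual_group_algebra G" "T \<subseteq> dual_group_algebra G"
  shows "dual_submodule G hull (S \<union> T) =
    rat_fun.span (dual_submodule G hull S \<union> dual_submodule G hull T)"
  using assms by (simp add: dual_submodule_hull dual_orbit_Un rat_fun.span_Un rat_fun.span_span)


section \<open>Dimensions\<close>

text \<open>By the exchange bound, an independent set in the span of a finite set is finite, so the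
  value \<open>\<infinity>\<close> occurs exactly for an infinite basis.\<close>

lemma rat_dimension_span:
  assumes "rat_fun.independent B"
  shows "rat_dimension (rat_fun.span B) = (if finite B then enat (card B) else \<infinity>)"
proof -
  have "finite B" if "finite C" "rat_fun.span B \<subseteq> rat_fun.span C" for C
    using rat_fun.independent_span_bound[OF that(1) assms] that(2) rat_fun.span_superset by blast
  then show ?thesis
    using rat_fun.dim_span_eq_card_independent[OF assms] by (auto simp: rat_dimension_def)
qed

lemma rat_fun_basis_extend:
  assumes "rat_fun.subspace V" "S \<subseteq> V" "rat_fun.independent S"
  obtains B where "S \<subseteq> B" "rat_fun.independent B" "V = rat_fun.span B"
proof -
  obtain B where "S \<subseteq> B" "B \<subseteq> V" "rat_fun.independent B" "V \<subseteq> rat_fun.span B"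
    using rat_fun.maximal_independent_subset_extend[OF assms(2,3)] by blast
  then show ?thesis
    using that rat_fun.span_minimal[OF _ assms(1)] by blast
qed

text \<open>An injective linear map sends a basis to a basis of the image, and the two bases are
  finite together and equal in cardinality.\<close>

lemma rat_dimension_image:
  assumes "module_hom fun_scale fun_scale F" "rat_fun.subspace V" "inj_on F V"
  shows "rat_dimension (F ` V) = rat_dimension V"
proof -
  obtain B where B: "rat_fun.independent B" "V = rat_fun.span B"
    using rat_fun_basis_extend[OF assms(2), of "{}"] rat_fun.independent_empty by blast
  have "inj_on F B"
    using assms(3) B(2) rat_fun.span_superset inj_on_subset by blast
  moreover have "rat_fun.independent (F ` B)"
    using module_hom.independent_injective_image[OF assms(1) B(1)] assms(3) B(2) by simp
  ultimately show ?thesis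
    unfolding B(2) module_hom.span_image[OF assms(1), symmetric]
    by (simp add: rat_dimension_span B(1) card_image finite_image_iff)
qed

text \<open>Split a vanishing combination into a part over \<open>A\<close> and a part over
  \<open>B\<close>. Each is the negative of the other, so both lie in the intersection of the spans
  and vanish.\<close>

lemma (in vector_space) independent_Un:
  assumes "independent A" "independent B" "span A \<inter> span B \<subseteq> {0}"
  shows "independent (A \<union> B)"
  unfolding independent_explicit_module
proof (intro allI impI)
  fix t u v
  assume t: "finite t" "t \<subseteq> A \<union> B" and eq: "(\<Sum>v\<in>t. u v *s v) = 0" and v: "v \<in> t"
  \<comment> \<open>Vectors common to \<open>A\<close> and \<open>B\<close> are counted with
    \<open>A\<close>; what remains of \<open>t\<close> lies in \<open>B\<close>.\<close>
  let ?x = "\<Sum>v\<in>t \<inter> A. u v *s v" and ?y = "\<Sum>v\<in>t - A. u v *s v"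
  have "?x + ?y = 0"
    using eq sum.Int_Diff[OF t(1), of "\<lambda>v. u v *s v" A] by simp
  moreover have "?x \<in> span A" "?y \<in> span B"
    using t(2) by (intro span_sum span_scale span_base; blast)+
  moreover from calculation have "?x \<in> span B"
    by (metis add_eq_0_iff2 span_neg)
  ultimately have "?x = 0" "?y = 0"
    using assms(3) by auto
  then show "u v = 0"
    using independentD[OF assms(1), of "t \<inter> A" u v] independentD[OF assms(2), of "t - A" u v] t v
    by auto
qed

text \<open>Extend \<open>c\<close> to a basis \<open>B\<close> of \<open>V\<close> and to a basis
  \<open>C\<close> of \<open>W\<close>; then \<open>B \<union> (C - {c})\<close> is a basis of the
  sum. Adding 1 on the left avoids subtraction in \<open>enat\<close>.\<close>

lemma rat_dimension_sum_line:
  assumes V: "rat_fun.subspace V" and W: "rat_fun.subspace W"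
    and VW: "V \<inter> W = rat_fun.span {c}" and "c \<noteq> 0"
  shows "rat_dimension (rat_fun.span (V \<union> W)) + 1 = rat_dimension V + rat_dimension W"
proof -
  have c: "rat_fun.independent {c}" "c \<in> V" "c \<in> W"
    using \<open>c \<noteq> 0\<close> VW rat_fun.span_base[of c "{c}"] by auto
  obtain B where B: "{c} \<subseteq> B" "rat_fun.independent B" "V = rat_fun.span B"
    using rat_fun_basis_extend[OF V _ c(1)] c by blast
  obtain C where C: "{c} \<subseteq> C" "rat_fun.independent C" "W = rat_fun.span C"
    using rat_fun_basis_extend[OF W _ c(1)] c by blast
  have c_notin: "c \<notin> rat_fun.span (C - {c})"
    using C(1,2) rat_fun.dependent_def by blast
  \<comment> \<open>A common vector is a multiple of \<open>c\<close>. A nonzero multiple would put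
    \<open>c\<close> into the span of \<open>C - {c}\<close>, against the independence of
    \<open>C\<close>.\<close>
  have int: "rat_fun.span B \<inter> rat_fun.span (C - {c}) \<subseteq> {0}"
  proof
    fix w assume w: "w \<in> rat_fun.span B \<inter> rat_fun.span (C - {c})"
    then have "w \<in> V \<inter> W"
      using B(3) C(3) rat_fun.span_mono[of "C - {c}" C] by blast
    then obtain q where q: "w = fun_scale q c"
      using VW by (auto simp: rat_fun.span_singleton)
    have "q = 0"
    proof (rule ccontr)
      assume "q \<noteq> 0"
      then have "c = fun_scale (inverse q) w" by (simp add: q)
      then show False
        using c_notin w rat_fun.span_scale by blast
    qed
    then show "w \<in> {0}" by (simp add: q)
  qed
  have ind: "rat_fun.independent (B \<union> (C - {c}))"
    using B(2) rat_fun.independent_mono[OF C(2)] int by (intro rat_fun.independent_Un) auto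
  have disj: "B \<inter> (C - {c}) = {}"
  proof (rule ccontr)
    assume "B \<inter> (C - {c}) \<noteq> {}"
    then obtain w where w: "w \<in> B" "w \<in> C - {c}" by blast
    then have "w \<in> rat_fun.span B \<inter> rat_fun.span (C - {c})"
      by (simp add: rat_fun.span_base)
    then have "w = 0" using int by auto
    then show False using w(1) B(2) rat_fun.dependent_zero[of B] by simp
  qed
  have "rat_fun.span (V \<union> W) = rat_fun.span (B \<union> C)"
    unfolding B(3) C(3) by (simp add: rat_fun.span_Un rat_fun.span_span)
  also have "B \<union> C = B \<union> (C - {c})" using B(1) by blast
  finally have "rat_dimension (rat_fun.span (V \<union> W)) =
      (if finite B \<and> finite C then enat (card B + card (C - {c})) else \<infinity>)"
    using rat_dimension_span[OF ind] disj by (simp add: card_Un_disjoint)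
  moreover have "card (C - {c}) + 1 = card C" if "finite C"
    using that C(1) by (metis Suc_eq_plus1 card.remove insert_subset)
  ultimately show ?thesis
    unfolding B(3) C(3) rat_dimension_span[OF B(2)] rat_dimension_span[OF C(2)]
    by (auto simp: one_enat_def)
qed


section \<open>Nickel modules\<close>

lemma malcev_coordinate_in_dual: "malcev_coordinate G as i \<in> dual_group_algebra G"
  by (simp add: malcev_coordinate_def dual_group_algebra_def)

lemma (in group) dual_submodule_nickel_module: "dual_submodule G (nickel_module G as)"
proof -
  have "malcev_coordinate G as ` {..<length as} \<subseteq> dual_group_algebra G"
    using malcev_coordinate_in_dual by blast
  then show ?thesis
    unfolding nickel_module_def by (simp add: dual_submodule_hull dual_submodule_span_orbit)
qed

text \<open>As an element of the dual, this is the augmentation map of the group algebra.\<close>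

definition unit_fun :: "('a, 'm) monoid_scheme \<Rightarrow> 'a \<Rightarrow> rat" where
  "unit_fun G = (\<lambda>g. if g \<in> carrier G then 1 else 0)"

text \<open>Right multiplication by the inverse of the last basis element lowers the last exponent
  by 1 and keeps the others; nonemptiness of \<open>as\<close> provides that element.\<close>

lemma (in group) unit_fun_in_nickel_module:
  assumes "malcev_basis G as" "as \<noteq> []"
  shows "unit_fun G \<in> nickel_module G as"
proof -
  let ?M = "nickel_module G as"
  obtain bs a where as: "as = bs @ [a]" using assms(2) by (metis rev_exhaust)
  let ?t = "malcev_coordinate G as (length bs)"
  have set_as: "set as \<subseteq> carrier G" using assms(1) by (simp add: malcev_basis_def)
  then have bs: "set bs \<subseteq> carrier G" and a: "a \<in> carrier G" by (auto simp: as)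
  have t: "?t \<in> ?M"
    unfolding nickel_module_def by (rule hull_inc) (simp add: as)
  have "unit_fun G = ?t - dual_act G ?t a"
  proof
    fix g
    show "unit_fun G g = (?t - dual_act G ?t a) g"
    proof (cases "g \<in> carrier G")
      case True
      obtain xs x where ex: "malcev_exponents G as g = xs @ [x]" "length xs = length bs"
        using malcev_exponents(1)[OF assms(1) True] as
        by (metis length_append_singleton length_Suc_conv_rev)
      have "g = malcev_word G bs xs \<otimes> a [^] x"
        using malcev_exponents(2)[OF assms(1) True] a ex bs unfolding as
        by (simp add: malcev_word_append)
      then have "g \<otimes> inv a = malcev_word G bs xs \<otimes> (a [^] x \<otimes> inv a)"
        using a bs by (simp add: m_assoc malcev_word_closed)
      also have "a [^] x \<otimes> inv a = a [^] (x - 1)"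
        using a by (simp add: int_pow_diff int_pow_1)
      also have "malcev_word G bs xs \<otimes> a [^] (x - 1) = malcev_word G as (xs @ [x - 1])"
        using a ex(2) bs by (simp add: as malcev_word_append)
      finally have "malcev_exponents G as (g \<otimes> inv a) = xs @ [x - 1]"
        using malcev_exponents_word[OF assms(1), of "xs @ [x - 1]"] ex(2) as set_as
        by (simp add: malcev_word_closed)
      then show ?thesis
        using True a ex by (simp add: unit_fun_def malcev_coordinate_def dual_act_def nth_append)
    qed (simp add: unit_fun_def malcev_coordinate_def dual_act_def)
  qed
  then show ?thesis
    using dual_submodule_nickel_module[of as] t a
    by (simp add: dual_submodule_def rat_fun.subspace_diff)
qed

text \<open>A central series of length 0 has the same first and last term, so the whole group would
  be trivial.\<close>

lemma malcev_basis_not_Nil: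
  assumes "group G" "\<not> trivial_group G" "malcev_basis G as"
  shows "as \<noteq> []"
  using assms by (auto simp: malcev_basis_def central_series_def trivial_group_def)


section \<open>The Nickel module of a direct product\<close>

context group_pair
begin

text \<open>The generating coordinates of the product are exactly the inflated coordinates of the
  factors, and generating a submodule commutes with inflation and turns unions into sums.\<close>

lemma nickel_module_prod_basis:
  assumes "malcev_basis G as" "malcev_basis H bs"
  shows "nickel_module (G \<times>\<times> H) (prod_basis G H as bs) = rat_fun.span
    (inflate (G \<times>\<times> H) fst ` nickel_module G as \<union> inflate (G \<times>\<times> H) snd ` nickel_module H bs)"
proof -
  let ?K = "G \<times>\<times> H" and ?cs = "prod_basis G H as bs"
  let ?A = "malcev_coordinate G as ` {..<length as}"
  let ?B = "malcev_coordinate H bs ` {..<length bs}"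
  have as: "set as \<subseteq> carrier G" and bs: "set bs \<subseteq> carrier H"
    using assms by (auto simp: malcev_basis_def)
  have exps: "malcev_exponents ?K ?cs (g, h) = malcev_exponents G as g @ malcev_exponents H bs h"
    if "g \<in> carrier G" "h \<in> carrier H" for g h
    using malcev_exponents_word[OF malcev_basis_prod_basis[OF assms],
        of "malcev_exponents G as g @ malcev_exponents H bs h"] that
      malcev_exponents[OF assms(1)] malcev_exponents[OF assms(2)]
    by (simp add: malcev_word_prod_basis[OF as bs])
  \<comment> \<open>Exponent lists are concatenated, so index \<open>i \<ge> length as\<close>
    refers to entry \<open>i - length as\<close> of the exponents in \<open>H\<close>.\<close>
  have coord: "malcev_coordinate ?K ?cs i =
      (if i < length as then inflate ?K fst (malcev_coordinate G as i)
       else inflate ?K snd (malcev_coordinate H bs (i - length as)))" for i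
    by (auto simp: fun_eq_iff malcev_coordinate_def inflate_def exps nth_append
        malcev_exponents[OF assms(1)])
  have "{..<length ?cs} = {..<length as} \<union> (+) (length as) ` {..<length bs}"
    by (simp add: lessThan_atLeast0 ivl_disj_un add.commute)
  moreover have "malcev_coordinate ?K ?cs ` {..<length as} = inflate ?K fst ` ?A"
    unfolding image_image by (rule image_cong) (simp_all add: coord)
  moreover have "malcev_coordinate ?K ?cs ` (+) (length as) ` {..<length bs} =
      inflate ?K snd ` ?B"
    unfolding image_image by (rule image_cong) (simp_all add: coord)
  ultimately have "malcev_coordinate ?K ?cs ` {..<length ?cs} =
      inflate ?K fst ` ?A \<union> inflate ?K snd ` ?B"
    by (simp only: image_Un)
  moreover have "?A \<subseteq> dual_group_algebra G" "?B \<subseteq> dual_group_algebra H"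
    using malcev_coordinate_in_dual by blast+
  moreover have "fst ` carrier ?K = carrier G" "snd ` carrier ?K = carrier H"
    by (auto simp: image_iff)
  moreover have "inflate ?K fst ` ?A \<subseteq> dual_group_algebra ?K"
    "inflate ?K snd ` ?B \<subseteq> dual_group_algebra ?K"
    using inflate_in_dual by blast+
  ultimately show ?thesis
    unfolding nickel_module_def
    by (simp add: prod.dual_submodule_hull_Un fst.inflate_hull snd.inflate_hull)
qed

lemma nickel_dimension_prod_basis:
  assumes "malcev_basis G as" "malcev_basis H bs" "as \<noteq> []" "bs \<noteq> []"
  shows "nickel_dimension (G \<times>\<times> H) (prod_basis G H as bs) + 1 =
    nickel_dimension G as + nickel_dimension H bs"
proof -
  let ?K = "G \<times>\<times> H"
  let ?M = "nickel_module G as" and ?N = "nickel_module H bs"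
  let ?V = "inflate ?K fst ` ?M" and ?W = "inflate ?K snd ` ?N"
  have M: "rat_fun.subspace ?M" "?M \<subseteq> dual_group_algebra G"
    using G.dual_submodule_nickel_module[of as] by (auto simp: dual_submodule_def)
  have N: "rat_fun.subspace ?N" "?N \<subseteq> dual_group_algebra H"
    using H.dual_submodule_nickel_module[of bs] by (auto simp: dual_submodule_def)
  have V: "rat_fun.subspace ?V" and W: "rat_fun.subspace ?W"
    using M(1) N(1) by (simp_all add: module_hom.subspace_image[OF module_hom_inflate])
  have "inflate ?K fst (unit_fun G) = unit_fun ?K" "inflate ?K snd (unit_fun H) = unit_fun ?K"
    by (auto simp: inflate_def unit_fun_def fun_eq_iff)
  then have unit: "unit_fun ?K \<in> ?V" "unit_fun ?K \<in> ?W"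
    using G.unit_fun_in_nickel_module[OF assms(1,3)] H.unit_fun_in_nickel_module[OF assms(2,4)]
    by (metis image_eqI)+
  have "?V \<inter> ?W = rat_fun.span {unit_fun ?K}"
  proof
    show "rat_fun.span {unit_fun ?K} \<subseteq> ?V \<inter> ?W"
      using unit V W by (intro rat_fun.span_minimal rat_fun.subspace_inter) auto
    show "?V \<inter> ?W \<subseteq> rat_fun.span {unit_fun ?K}"
    proof
      fix f assume "f \<in> ?V \<inter> ?W"
      then obtain u v where u: "f = inflate ?K fst u" and v: "f = inflate ?K snd v" by blast
      \<comment> \<open>The second component may be changed because \<open>f\<close> is inflated
        along \<open>fst\<close>, then the first because \<open>f\<close> is inflated along
        \<open>snd\<close>.\<close>
      have const: "f (g, h) = f (\<one>\<^bsub>G\<^esub>, \<one>\<^bsub>H\<^esub>)" if "g \<in> carrier G" "h \<in> carrier H" for g h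
      proof -
        have "f (g, h) = f (g, \<one>\<^bsub>H\<^esub>)" using that by (simp add: u inflate_def)
        also have "\<dots> = f (\<one>\<^bsub>G\<^esub>, \<one>\<^bsub>H\<^esub>)" using that by (simp add: v inflate_def)
        finally show ?thesis .
      qed
      have "f = fun_scale (f (\<one>\<^bsub>G\<^esub>, \<one>\<^bsub>H\<^esub>)) (unit_fun ?K)"
      proof
        fix x
        show "f x = fun_scale (f (\<one>\<^bsub>G\<^esub>, \<one>\<^bsub>H\<^esub>)) (unit_fun ?K) x"
        proof (cases "x \<in> carrier ?K")
          case True
          then obtain g h where "x = (g, h)" "g \<in> carrier G" "h \<in> carrier H" by auto
          then show ?thesis using const[of g h] by (simp add: fun_scale_def unit_fun_def)
        qed (simp add: u inflate_def fun_scale_def unit_fun_def)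
      qed
      then show "f \<in> rat_fun.span {unit_fun ?K}"
        by (metis rangeI rat_fun.span_singleton)
    qed
  qed
  moreover have "unit_fun ?K (\<one>\<^bsub>G\<^esub>, \<one>\<^bsub>H\<^esub>) \<noteq> 0"
    by (simp add: unit_fun_def)
  then have "unit_fun ?K \<noteq> 0"
    by (metis zero_fun_apply)
  ultimately have "rat_dimension (rat_fun.span (?V \<union> ?W)) + 1 = rat_dimension ?V + rat_dimension ?W"
    by (rule rat_dimension_sum_line[OF V W])
  moreover have "fst ` carrier ?K = carrier G" "snd ` carrier ?K = carrier H"
    by (auto simp: image_iff)
  \<comment> \<open>Both projections are onto, so inflation is injective and preserves the
    dimensions of the two modules.\<close>
  then have "inj_on (inflate ?K fst) ?M" "inj_on (inflate ?K snd) ?N"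
    using inj_on_inflate inj_on_subset M(2) N(2) by metis+
  then have "rat_dimension ?V = rat_dimension ?M" "rat_dimension ?W = rat_dimension ?N"
    using rat_dimension_image[OF module_hom_inflate] M(1) N(1) by blast+
  ultimately show ?thesis
    unfolding nickel_dimension_def nickel_module_prod_basis[OF assms(1,2)] by simp
qed

end

theorem proposition6p2:
  fixes G :: "('a, 'm) monoid_scheme" and H :: "('b, 'n) monoid_scheme"
    and as :: "'a list" and bs :: "'b list" and M N :: enat
  assumes "group G" "finitely_generated_group G" "torsion_free_group G" "nilpotent_group G"
    and "group H" "finitely_generated_group H" "torsion_free_group H" "nilpotent_group H"
    and "\<not> trivial_group G" "\<not> trivial_group H"
    and "malcev_basis G as" "malcev_basis H bs"
    and "M = nickel_dimension G as" "N = nickel_dimension H bs"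
  defines "cs \<equiv> map (\<lambda>a. (a, \<one>\<^bsub>H\<^esub>)) as @ map (\<lambda>b. (\<one>\<^bsub>G\<^esub>, b)) bs"
  shows "malcev_basis (G \<times>\<times> H) cs \<and> nickel_dimension (G \<times>\<times> H) cs = M + N - 1"
proof -
  interpret group_pair G H
    using assms(1,5) by (rule group_pair.intro)
  have cs: "cs = prod_basis G H as bs"
    by (simp add: cs_def prod_basis_def)
  \<comment> \<open>Here nontriviality enters: each factor has a last coordinate, hence the
    constants in its Nickel module.\<close>
  have "as \<noteq> []" "bs \<noteq> []"
    using malcev_basis_not_Nil assms by blast+
  then have "nickel_dimension (G \<times>\<times> H) cs + 1 = M + N"
    using nickel_dimension_prod_basis assms(11-14) cs by simp
  \<comment> \<open>Cancellation in \<open>enat\<close> is valid because the cancelled summand 1 is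
    finite.\<close>
  then have "nickel_dimension (G \<times>\<times> H) cs = M + N - 1"
    by (metis add.commute add_diff_cancel_enat one_enat_def enat.distinct(2))
  then show ?thesis
    using malcev_basis_prod_basis assms(11,12) cs by simp
qed

end
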